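(* Let $\kappa\in\mathcal{L}$ with $f(|m(\kappa)|)<B$, let $\hat\kappa(n)$ be the empirical distribution of $n$ i.i.d. samples from $\kappa$, and let $u\ge0$. Then \[ \mathbb{P}\big(\mathrm{KL}_{\inf}(\hat\kappa(n),m(\kappa))\ge u\big)\le (n+1)^2e^{\tilde B_1}e^{-nu}, \] where $\tilde B_1=d_1+d_2$ with $d_1=\frac{\mathbb{E}_\kappa|X-m(\kappa)|}{2(f^{-1}(B)-m(\kappa))}$ and $d_2=\frac{\mathbb{E}_\kappa|B-f(|X|)|}{2(B-f(|m(\kappa)|))}$.
   Context: $\mathcal{P}(\mathbb{R})$: probability distributions on $\mathbb{R}$ with finite mean; $m(\eta)$: mean. Fix a strictly increasing, continuous, non-negative, convex $f:[0,\infty)\to[0,\infty)$ with $f(y)/y\to\infty$, and $B>0$; $\mathcal{L}=\{\eta\in\mathcal{P}(\mathbb{R}):\mathbb{E}_\eta f(|X|)\le B\}$. $\mathrm{KL}(\eta,\kappa)=\int\log\frac{d\eta}{d\kappa}d\eta$ ($+\infty$ if $\eta\not\ll\kappa$). For $\eta\in\mathcal{P}(\mathbb{R})$ and $f(|x|)<B$: $\mathrm{KL}_{\inf}(\eta,x)=\inf\{\mathrm{KL}(\eta,\kappa'):\kappa'\in\mathcal{L},m(\kappa')\ge x\}$ if $x\ge m(\eta)$, and $=\inf\{\mathrm{KL}(\eta,\kappa'):\kappa'\in\mathcal{L},m(\kappa')\le x\}$ if $x<m(\eta)$. *)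

theory Defs
  imports "HOL-Probability.Probability"
begin

definition Pfin :: "real measure set" where
  "Pfin = {\<eta>. prob_space \<eta> \<and> sets \<eta> = sets borel \<and> integrable \<eta> (\<lambda>x. x)}"

definition mean :: "real measure \<Rightarrow> real" where
  "mean \<eta> = (\<integral>x. x \<partial>\<eta>)"

definition Lclass :: "(real \<Rightarrow> real) \<Rightarrow> real \<Rightarrow> real measure set" where
  "Lclass f B = {\<eta> \<in> Pfin. (\<integral>\<^sup>+x. ennreal (f \<bar>x\<bar>) \<partial>\<eta>) \<le> ennreal B}"

text \<open>KL(eta, kappa) = int log (d eta / d kappa) d eta, +infinity if eta is not
  absolutely continuous w.r.t. kappa (the negative part of the integrand is
  always eta-integrable, so non-integrability means the value +infinity).\<close>
definition KL :: "real measure \<Rightarrow> real measure \<Rightarrow> ereal" where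
  "KL \<eta> \<kappa> =
    (if absolutely_continuous \<kappa> \<eta> then
       (if integrable \<eta> (\<lambda>x. ln (enn2real (RN_deriv \<kappa> \<eta> x)))
        then ereal (\<integral>x. ln (enn2real (RN_deriv \<kappa> \<eta> x)) \<partial>\<eta>)
        else \<infinity>)
     else \<infinity>)"

definition KLinf :: "(real \<Rightarrow> real) \<Rightarrow> real \<Rightarrow> real measure \<Rightarrow> real \<Rightarrow> ereal" where
  "KLinf f B \<eta> x =
    (if x \<ge> mean \<eta>
     then (INF \<kappa>' \<in> {\<kappa>' \<in> Lclass f B. mean \<kappa>' \<ge> x}. KL \<eta> \<kappa>')
     else (INF \<kappa>' \<in> {\<kappa>' \<in> Lclass f B. mean \<kappa>' \<le> x}. KL \<eta> \<kappa>'))"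

definition empirical :: "nat \<Rightarrow> (nat \<Rightarrow> real) \<Rightarrow> real measure" where
  "empirical n X = distr (uniform_count_measure {..<n}) borel X"

definition finv :: "(real \<Rightarrow> real) \<Rightarrow> real \<Rightarrow> real" where
  "finv f B = (THE y. y \<ge> 0 \<and> f y = B)"

end

theory Submission
  imports Defs
begin

text \<open>
  Write \<open>\<phi> y = f \<bar>y\<bar>\<close>, \<open>m\<close> for the mean of \<open>\<kappa>\<close>, and
  \<open>L \<theta> y = 1 - \<theta>\<^sub>1 (y - m) - \<theta>\<^sub>2 (B - \<phi> y)\<close>; let \<open>R\<close> be the compact convex set of all \<open>\<theta>\<close> with
  \<open>\<theta>\<^sub>2 \<ge> 0\<close> and \<open>L \<theta> \<ge> 0\<close> everywhere. The first-order conditions for a maximiser \<open>\<theta>\<close> of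
  \<open>\<Prod>\<^sub>t L \<theta> (X\<^sub>t)\<close> over the part of \<open>R\<close> where \<open>\<theta>\<^sub>1\<close> has the appropriate sign say that the
  reweighted empirical measure with density \<open>1 / L \<theta>\<close> can be completed by a single atom to an
  element of the class with mean on the correct side of \<open>m\<close>. Hence \<open>KLinf \<ge> u\<close> forces
  \<open>\<Prod>\<^sub>t L \<theta> (X\<^sub>t) \<ge> exp (n u)\<close> for some \<open>\<theta> \<in> R\<close>. For each fixed \<open>\<theta> \<in> R\<close> this product has
  expectation at most 1, hence so does its average over \<open>R\<close>, and that average is at least
  \<open>2 / ((n + 1) (n + 2))\<close> times the supremum, because the product is built from \<open>n\<close> non-negative
  affine functions of a two-dimensional parameter. Markov's inequality concludes, with constant
  \<open>(n + 1) (n + 2) / 2 \<le> (n + 1)\<^sup>2\<close>.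
\<close>

section \<open>The dual region\<close>

text \<open>The sum is the derivative at \<open>s = 0\<close> of the product, whose value there is
  1; a positive derivative would lift the product above 1 for small \<open>s > 0\<close>. This
  yields first-order conditions without logarithms.\<close>

lemma sum_nonpos_if_prod_le_1:
  fixes x :: "'i \<Rightarrow> real"
  assumes "finite I" and le: "\<And>s. 0 \<le> s \<Longrightarrow> s \<le> 1 \<Longrightarrow> (\<Prod>t\<in>I. 1 + s * x t) \<le> 1"
  shows "sum x I \<le> 0"
proof (rule ccontr)
  assume "\<not> sum x I \<le> 0"
  then have pos: "0 < sum x I" by simp
  have "((\<lambda>s. \<Prod>t\<in>I. 1 + s * x t) has_real_derivative sum x I) (at 0)"
    using \<open>finite I\<close>
  proof (induction I rule: finite_induct)
    case (insert i I)
    have "((\<lambda>s. (1 + s * x i) * (\<Prod>t\<in>I. 1 + s * x t)) has_real_derivative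
        x i * (\<Prod>t\<in>I. 1 + 0 * x t) + sum x I * (1 + 0 * x i)) (at 0)"
      by (rule DERIV_mult[OF _ insert.IH]) (auto intro!: derivative_eq_intros)
    then show ?case
      using insert.hyps by simp
  qed simp
  from DERIV_pos_inc_right[OF this pos] obtain d where d: "d > 0" and
    "\<And>h. h > 0 \<Longrightarrow> h < d \<Longrightarrow> (\<Prod>t\<in>I. 1 + 0 * x t) < (\<Prod>t\<in>I. 1 + (0 + h) * x t)"
    by blast
  from this(2)[of "min (d/2) 1"] d have "1 < (\<Prod>t\<in>I. 1 + min (d/2) 1 * x t)"
    by simp
  with le[of "min (d/2) 1"] d show False
    by auto
qed

text \<open>The integrand dual to the KL projection: \<open>fst \<theta>\<close> is the multiplier
  of the mean constraint, \<open>snd \<theta>\<close> that of the moment constraint.\<close>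

definition lagrangian :: "(real \<Rightarrow> real) \<Rightarrow> real \<Rightarrow> real \<Rightarrow> real \<times> real \<Rightarrow> real \<Rightarrow> real" where
  "lagrangian \<phi> B m \<theta> y = 1 - fst \<theta> * (y - m) - snd \<theta> * (B - \<phi> y)"

text \<open>The first multiplier may have either sign, so that one region serves both
  branches of \<^const>\<open>KLinf\<close>.\<close>
definition dual_region :: "(real \<Rightarrow> real) \<Rightarrow> real \<Rightarrow> real \<Rightarrow> (real \<times> real) set" where
  "dual_region \<phi> B m = {\<theta>. snd \<theta> \<ge> 0 \<and> (\<forall>y. lagrangian \<phi> B m \<theta> y \<ge> 0)}"

lemma lagrangian_convex_comb:
  "lagrangian \<phi> B m ((1 - s) *\<^sub>R a + s *\<^sub>R b) y
     = (1 - s) * lagrangian \<phi> B m a y + s * lagrangian \<phi> B m b y"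
  by (simp add: lagrangian_def algebra_simps)

lemma continuous_on_lagrangian [continuous_intros]: "continuous_on A (\<lambda>\<theta>. lagrangian \<phi> B m \<theta> y)"
  unfolding lagrangian_def by (intro continuous_intros)

lemma closed_dual_region: "closed (dual_region \<phi> B m)"
  unfolding dual_region_def
  by (intro closed_Collect_conj closed_Collect_all closed_Collect_le continuous_intros)

lemma convex_comb_dual_region:
  assumes "a \<in> dual_region \<phi> B m" "b \<in> dual_region \<phi> B m" "0 \<le> s" "s \<le> 1"
  shows "(1 - s) *\<^sub>R a + s *\<^sub>R b \<in> dual_region \<phi> B m"
  using assms by (auto simp: dual_region_def lagrangian_convex_comb)

lemma zero_in_dual_region: "0 \<in> dual_region \<phi> B m"
  by (simp add: dual_region_def lagrangian_def)

text \<open>\<open>\<phi>\<close> stands for \<open>y \<mapsto> f \<bar>y\<bar>\<close>. The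
  assumptions survive replacing \<open>m\<close> by \<open>- m\<close>, so one argument serves both
  branches of \<open>KLinf\<close>.\<close>

locale moment_constraint =
  fixes \<phi> :: "real \<Rightarrow> real" and B m :: real
  assumes convex: "convex_on UNIV \<phi>"
    and even: "\<phi> (- y) = \<phi> y"
    and superlinear: "\<exists>K. \<forall>y. \<phi> y \<ge> A * \<bar>y\<bar> - K"
    and mean_interior: "\<phi> m < B"
begin

abbreviation "L \<equiv> lagrangian \<phi> B m"
abbreviation "R \<equiv> dual_region \<phi> B m"

section \<open>Convexity of \<open>\<phi>\<close> and the size of the dual region\<close>

lemma phi_0_le: "\<phi> 0 \<le> \<phi> y"
  using convex_onD[OF convex, of "1/2" y "- y"] even[of y] by simp

lemma subgradient: obtains g where "\<And>y. \<phi> y \<ge> \<phi> x + g * (y - x)"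
  using convex_le_Inf_differential[OF convex, of x] by auto

text \<open>Three evaluation points suffice: \<open>y = m\<close> bounds
  \<open>snd \<theta>\<close>, and then \<open>y = m + 1\<close> and \<open>y = m - 1\<close> bound
  \<open>fst \<theta>\<close> from above and below.\<close>

lemma compact_dual_region: "compact R"
proof -
  let ?C = "1 / (B - \<phi> m)"
  have "R \<subseteq> cbox (- (1 + \<bar>B - \<phi> (m - 1)\<bar> * ?C), 0) (1 + \<bar>B - \<phi> (m + 1)\<bar> * ?C, ?C)"
  proof
    fix \<theta> assume \<theta>: "\<theta> \<in> R"
    then have 0: "0 \<le> snd \<theta>" and l: "\<And>y. L \<theta> y \<ge> 0"
      by (auto simp: dual_region_def)
    have C: "snd \<theta> \<le> ?C"
      using l[of m] mean_interior by (simp add: lagrangian_def field_simps)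
    have *: "- (snd \<theta> * x) \<le> \<bar>x\<bar> * ?C" for x
    proof -
      have "- (snd \<theta> * x) \<le> \<bar>x\<bar> * snd \<theta>"
        using 0 by (metis abs_ge_minus_self abs_mult abs_of_nonneg mult.commute)
      also have "\<dots> \<le> \<bar>x\<bar> * ?C"
        by (rule mult_left_mono[OF C]) simp
      finally show ?thesis .
    qed
    have "fst \<theta> \<le> 1 + \<bar>B - \<phi> (m + 1)\<bar> * ?C"
      using l[of "m + 1"] *[of "B - \<phi> (m + 1)"]
      by (simp add: lagrangian_def)
    moreover have "- (1 + \<bar>B - \<phi> (m - 1)\<bar> * ?C) \<le> fst \<theta>"
      using l[of "m - 1"] *[of "B - \<phi> (m - 1)"]
      by (simp add: lagrangian_def)
    ultimately show "\<theta> \<in> cbox (- (1 + \<bar>B - \<phi> (m - 1)\<bar> * ?C), 0) (1 + \<bar>B - \<phi> (m + 1)\<bar> * ?C, ?C)"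
      using 0 C by (simp add: cbox_Pair_eq mem_Times_iff)
  qed
  then show ?thesis
    unfolding compact_eq_bounded_closed
    using closed_dual_region by (auto intro: bounded_subset[OF bounded_cbox])
qed

text \<open>Superlinearity with slope 1 lets \<open>snd \<theta> * \<phi> y\<close> dominate the
  linear term once \<open>snd \<theta> \<ge> \<bar>fst \<theta>\<bar>\<close>, so a small box fits
  into \<open>R\<close>.\<close>

lemma emeasure_dual_region_pos: "emeasure lborel R > 0"
proof -
  obtain K where K: "\<phi> y \<ge> 1 * \<bar>y\<bar> - K" for y
    using superlinear[of 1] by blast
  \<comment> \<open>On the box below, the constant terms of \<open>L \<theta> y\<close> cost at most
    \<open>e * (\<bar>m\<bar> + 2 * \<bar>B + K\<bar>)\<close>, which must not exceed 1.\<close>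
  define e where "e = 1 / (\<bar>m\<bar> + 2 * \<bar>B + K\<bar> + 1)"
  have e: "e > 0" "e * (\<bar>m\<bar> + 2 * \<bar>B + K\<bar>) \<le> 1"
    unfolding e_def by (auto simp: field_simps add_pos_nonneg)
  have "cbox (- e, e) (e, 2 * e) \<subseteq> R"
  proof
    fix \<theta> assume "\<theta> \<in> cbox (- e, e) (e, 2 * e)"
    then have \<theta>: "\<bar>fst \<theta>\<bar> \<le> e" "e \<le> snd \<theta>" "snd \<theta> \<le> 2 * e"
      by (cases \<theta>; auto)+
    have "L \<theta> y \<ge> 0" for y
    proof -
      have "fst \<theta> * (y - m) \<le> \<bar>fst \<theta>\<bar> * \<bar>y - m\<bar>"
        by (metis abs_ge_self abs_mult)
      also have "\<dots> \<le> e * (\<bar>y\<bar> + \<bar>m\<bar>)"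
        using \<theta> e by (intro mult_mono) auto
      finally have 1: "fst \<theta> * (y - m) \<le> e * \<bar>y\<bar> + e * \<bar>m\<bar>"
        by (simp add: algebra_simps)
      have "snd \<theta> * (B - \<phi> y) \<le> snd \<theta> * (\<bar>B + K\<bar> - \<bar>y\<bar>)"
        using \<theta> e K[of y] by (intro mult_left_mono) auto
      also have "\<dots> = snd \<theta> * \<bar>B + K\<bar> - snd \<theta> * \<bar>y\<bar>"
        by (simp add: algebra_simps)
      also have "\<dots> \<le> 2 * e * \<bar>B + K\<bar> - e * \<bar>y\<bar>"
        using \<theta> by (intro diff_mono mult_right_mono) auto
      finally show ?thesis
        using 1 e by (simp add: lagrangian_def algebra_simps)
    qed
    then show "\<theta> \<in> R"
      using \<theta> e by (auto simp: dual_region_def)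
  qed
  then have "emeasure lborel (cbox (- e, e) (e, 2 * e)) \<le> emeasure lborel R"
    using closed_dual_region by (intro emeasure_mono) auto
  moreover have "emeasure lborel (cbox (- e, e) (e, 2 * e)) > 0"
    using e by (subst emeasure_lborel_cbox) (auto simp: Basis_prod_def ennreal_mult[symmetric])
  ultimately show ?thesis
    by order
qed

text \<open>The supporting line of \<open>\<phi>\<close> at \<open>max c 0\<close>, the minimiser of \<open>\<phi>\<close> on \<open>[c, \<infinity>)\<close>, has
  non-negative slope and, suitably scaled, is a pair of multipliers. Testing with it shows that
  a single atom carries the whole missing mass \<open>\<delta>\<close>.\<close>
lemma dual_cone_atom:
  assumes polar: "\<And>\<mu>. \<mu> \<in> R \<Longrightarrow> fst \<mu> \<ge> 0 \<Longrightarrow> - fst \<mu> * a - snd \<mu> * b \<le> \<delta>"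
  obtains y where "a + \<delta> * (y - m) \<ge> 0" "b + \<delta> * (B - \<phi> y) \<ge> 0"
proof -
  \<comment> \<open>Dividing the pair \<open>(g, 1)\<close> by an upper bound \<open>k\<close> of
    its constraint function moves it into \<open>R\<close>, where \<open>polar\<close>
    applies.\<close>
  have scaled: "- g * a - b \<le> \<delta> * k"
    if "g \<ge> 0" "k > 0" "\<And>y. g * (y - m) + (B - \<phi> y) \<le> k" for g k
  proof -
    have "L (g / k, 1 / k) y \<ge> 0" for y
    proof -
      have "L (g / k, 1 / k) y = (k - (g * (y - m) + (B - \<phi> y))) / k"
        using that by (simp add: lagrangian_def field_simps)
      then show ?thesis
        using that(2) that(3)[of y] by simp
    qed
    then have "(g / k, 1 / k) \<in> R"
      using that by (simp add: dual_region_def)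
    from polar[OF this] that show ?thesis
      by (simp add: field_simps)
  qed
  have "\<delta> \<ge> 0"
    using polar[OF zero_in_dual_region] by simp
  show ?thesis
  proof (cases "\<delta> = 0")
    case True
    \<comment> \<open>An atom without mass cannot help, so \<open>a\<close> and \<open>b\<close>
      must be non-negative themselves. Superlinearity makes every slope \<open>g \<ge> 0\<close>
      admissible here.\<close>
    have lin: "- g * a - b \<le> 0" if "g \<ge> 0" for g
    proof -
      obtain K where K: "\<phi> y \<ge> g * \<bar>y\<bar> - K" for y
        using superlinear[of g] by blast
      have "g * (y - m) + (B - \<phi> y) \<le> \<bar>B + K\<bar> + g * \<bar>m\<bar> + 1" for y
      proof -
        have "g * (y - m) \<le> g * (\<bar>y\<bar> + \<bar>m\<bar>)"
          using that by (intro mult_left_mono) auto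
        then show ?thesis
          using K[of y] by (simp add: algebra_simps)
      qed
      from scaled[OF that _ this] that True show ?thesis
        by (simp add: add_nonneg_pos)
    qed
    have "b \<ge> 0"
      using lin[of 0] by simp
    moreover have "a \<ge> 0"
    proof (rule ccontr)
      assume "\<not> a \<ge> 0"
      with lin[of "- (b + 1) / a"] \<open>b \<ge> 0\<close> show False
        by (simp add: divide_nonpos_neg)
    qed
    ultimately show ?thesis
      using True that[of 0] by simp
  next
    case False
    with \<open>\<delta> \<ge> 0\<close> have \<delta>: "\<delta> > 0" by simp
    \<comment> \<open>The leftmost location at which an atom of mass \<open>\<delta>\<close> repairs
      the mean constraint.\<close>
    define c where "c = m - a / \<delta>"
    define y where "y = max c 0"
    \<comment> \<open>\<open>g * (y - c) = 0\<close> is complementary slackness: either the atom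
      sits at \<open>c\<close> or the slope is 0.\<close>
    obtain g where g: "g \<ge> 0" "g * (y - c) = 0" "\<And>z. \<phi> z \<ge> \<phi> y + g * (z - y)"
    proof (cases "c \<le> 0")
      case True
      then show ?thesis
        using phi_0_le by (intro that[of 0]) (auto simp: y_def)
    next
      case False
      obtain g where g: "\<And>z. \<phi> z \<ge> \<phi> c + g * (z - c)"
        using subgradient by blast
      have "g * c \<ge> 0"
        using g[of 0] phi_0_le[of c] by simp
      then have "g \<ge> 0"
        using False by (simp add: zero_le_mult_iff)
      then show ?thesis
        using False g by (intro that[of g]) (auto simp: y_def)
    qed
    \<comment> \<open>The maximum over \<open>z\<close> of
      \<open>g * (z - m) + (B - \<phi> z)\<close>, attained at \<open>y\<close>; slackness allows
      \<open>c\<close> for \<open>y\<close> in the linear term.\<close>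
    define k where "k = g * (c - m) + (B - \<phi> y)"
    have k: "g * (z - m) + (B - \<phi> z) \<le> k" for z
    proof -
      have "g * (y - m) = g * (c - m)"
        using g(2) by auto
      moreover have "g * (z - y) = g * (z - m) - g * (y - m)"
        by (simp add: algebra_simps)
      ultimately show ?thesis
        using g(3)[of z] unfolding k_def by linarith
    qed
    have "k > 0"
      using k[of m] mean_interior by simp
    from scaled[OF g(1) this k] have "- g * a - b \<le> \<delta> * k" .
    also have "\<delta> * k = - g * a + \<delta> * (B - \<phi> y)"
      using \<delta> by (simp add: k_def c_def field_simps)
    finally have "b + \<delta> * (B - \<phi> y) \<ge> 0" by simp
    moreover have "a + \<delta> * (y - m) \<ge> 0"
    proof -
      have "\<delta> * (y - m) \<ge> \<delta> * (c - m)"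
        using \<delta> by (intro mult_left_mono) (auto simp: y_def)
      then show ?thesis
        using \<delta> by (simp add: c_def)
    qed
    ultimately show ?thesis
      using that by blast
  qed
qed

text \<open>Compactness gives a maximiser. The first-order conditions there are the polar inequality
  that \<open>dual_cone_atom\<close> turns into an atom carrying \<open>\<delta>\<close>, the mass
  lost in the reweighting.\<close>

lemma dual_optimum:
  fixes X :: "nat \<Rightarrow> real"
  assumes "n \<ge> 1"
  obtains \<theta> \<delta> y where "\<theta> \<in> R" "\<And>t. t < n \<Longrightarrow> L \<theta> (X t) > 0" "\<delta> \<ge> 0"
    "\<delta> + (\<Sum>t<n. 1 / (n * L \<theta> (X t))) = 1"
    "(\<Sum>t<n. 1 / (n * L \<theta> (X t)) * (X t - m)) + \<delta> * (y - m) \<ge> 0"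
    "(\<Sum>t<n. 1 / (n * L \<theta> (X t)) * (B - \<phi> (X t))) + \<delta> * (B - \<phi> y) \<ge> 0"
proof -
  let ?S = "R \<inter> {\<theta>. fst \<theta> \<ge> 0}"
  let ?p = "\<lambda>\<theta>. \<Prod>t<n. L \<theta> (X t)"
  have "compact ?S"
    using compact_dual_region by (intro compact_Int_closed closed_Collect_le continuous_intros)
  moreover have S0: "0 \<in> ?S"
    by (simp add: zero_in_dual_region)
  ultimately obtain \<theta> where \<theta>: "\<theta> \<in> ?S" and max: "\<And>\<mu>. \<mu> \<in> ?S \<Longrightarrow> ?p \<mu> \<le> ?p \<theta>"
    using continuous_attains_sup[of ?S ?p] continuous_on_prod[of "{..<n}" ?S "\<lambda>t \<theta>. L \<theta> (X t)"]
      continuous_on_lagrangian by blast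
  \<comment> \<open>The product is 1 at the zero multiplier, so no factor can vanish at the
    maximiser.\<close>
  have "?p \<theta> \<ge> 1"
    using max[OF S0] by (simp add: lagrangian_def)
  then have "?p \<theta> \<noteq> 0" by linarith
  then have pos: "L \<theta> (X t) > 0" if "t < n" for t
    using that \<theta> by (auto simp: dual_region_def order_less_le)
  \<comment> \<open>The one-sided derivative of the product at \<open>\<theta>\<close> along the
    segment towards \<open>\<mu>\<close> is non-positive.\<close>
  have first_order: "(\<Sum>t<n. L \<mu> (X t) / (n * L \<theta> (X t))) \<le> 1" if \<mu>: "\<mu> \<in> ?S" for \<mu>
  proof -
    have "(\<Sum>t<n. L \<mu> (X t) / L \<theta> (X t) - 1) \<le> 0"
    proof (rule sum_nonpos_if_prod_le_1)
      fix s :: real assume s: "0 \<le> s" "s \<le> 1"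
      then have "(1 - s) *\<^sub>R \<theta> + s *\<^sub>R \<mu> \<in> ?S"
        using \<theta> \<mu> convex_comb_dual_region by auto
      then have "?p ((1 - s) *\<^sub>R \<theta> + s *\<^sub>R \<mu>) \<le> ?p \<theta>"
        by (rule max)
      moreover have "?p ((1 - s) *\<^sub>R \<theta> + s *\<^sub>R \<mu>)
          = ?p \<theta> * (\<Prod>t<n. 1 + s * (L \<mu> (X t) / L \<theta> (X t) - 1))"
        unfolding prod.distrib[symmetric]
      proof (intro prod.cong refl)
        fix t assume "t \<in> {..<n}"
        then show "L ((1 - s) *\<^sub>R \<theta> + s *\<^sub>R \<mu>) (X t)
            = L \<theta> (X t) * (1 + s * (L \<mu> (X t) / L \<theta> (X t) - 1))"
          using pos[of t] unfolding lagrangian_convex_comb by (simp add: field_simps)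
      qed
      ultimately show "(\<Prod>t<n. 1 + s * (L \<mu> (X t) / L \<theta> (X t) - 1)) \<le> 1"
        using \<open>?p \<theta> \<ge> 1\<close> by simp
    qed simp
    then have "(\<Sum>t<n. L \<mu> (X t) / L \<theta> (X t)) \<le> n"
      by (simp add: sum_subtractf)
    then have "(\<Sum>t<n. L \<mu> (X t) / L \<theta> (X t)) / n \<le> 1"
      using assms by simp
    then show ?thesis
      by (simp add: sum_divide_distrib mult.commute)
  qed
  define w where "w t = 1 / (n * L \<theta> (X t))" for t
  define \<delta> where "\<delta> = 1 - (\<Sum>t<n. w t)"
  \<comment> \<open>\<open>L \<mu>\<close> is affine in \<open>\<mu>\<close> with constant term 1,
    so this is \<open>first_order\<close> sorted by the coordinates of \<open>\<mu>\<close>.\<close>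
  have polar: "- fst \<mu> * (\<Sum>t<n. w t * (X t - m)) - snd \<mu> * (\<Sum>t<n. w t * (B - \<phi> (X t))) \<le> \<delta>"
    if "\<mu> \<in> R" "fst \<mu> \<ge> 0" for \<mu>
  proof -
    have "(\<Sum>t<n. L \<mu> (X t) / (n * L \<theta> (X t)))
       = (\<Sum>t<n. w t - fst \<mu> * (w t * (X t - m)) - snd \<mu> * (w t * (B - \<phi> (X t))))"
      by (intro sum.cong refl)
        (simp add: w_def lagrangian_def[of _ _ _ \<mu>] diff_divide_distrib[of "_ - _"]
          diff_divide_distrib[of 1])
    also have "\<dots> = (\<Sum>t<n. w t) - fst \<mu> * (\<Sum>t<n. w t * (X t - m))
        - snd \<mu> * (\<Sum>t<n. w t * (B - \<phi> (X t)))"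
      by (simp add: sum_subtractf sum_distrib_left)
    finally show ?thesis
      using first_order[of \<mu>] that by (simp add: \<delta>_def)
  qed
  then obtain y where "(\<Sum>t<n. w t * (X t - m)) + \<delta> * (y - m) \<ge> 0"
      "(\<Sum>t<n. w t * (B - \<phi> (X t))) + \<delta> * (B - \<phi> y) \<ge> 0"
    by (rule dual_cone_atom)
  moreover have "\<delta> \<ge> 0"
    using polar[OF zero_in_dual_region] by simp
  ultimately show ?thesis
    using \<theta> pos by (intro that[of \<theta> \<delta> y]) (auto simp: w_def \<delta>_def)
qed

end

section \<open>Finitely supported measures\<close>

text \<open>Weights are attached to indices and not to points of the line, so tied samples need no
  special treatment: their weights add up.\<close>

definition atomic_measure :: "'i set \<Rightarrow> ('i \<Rightarrow> real) \<Rightarrow> ('i \<Rightarrow> real) \<Rightarrow> real measure" where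
  "atomic_measure I w Y = distr (point_measure I (\<lambda>t. ennreal (w t))) borel Y"

lemma sets_atomic_measure [measurable_cong]: "sets (atomic_measure I w Y) = sets borel"
  by (simp add: atomic_measure_def)

lemma nn_integral_atomic_measure:
  assumes "finite I" "g \<in> borel_measurable borel"
  shows "(\<integral>\<^sup>+x. g x \<partial>atomic_measure I w Y) = (\<Sum>t\<in>I. ennreal (w t) * g (Y t))"
  unfolding atomic_measure_def using assms
  by (subst nn_integral_distr) (auto simp: nn_integral_point_measure_finite)

lemma integrable_atomic_measure:
  fixes g :: "real \<Rightarrow> real"
  assumes "finite I" "g \<in> borel_measurable borel"
  shows "integrable (atomic_measure I w Y) g"
  unfolding atomic_measure_def using assms
  by (subst integrable_distr_eq) (auto intro: integrable_point_measure_finite)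

lemma integral_atomic_measure:
  fixes g :: "real \<Rightarrow> real"
  assumes "finite I" "\<And>t. t \<in> I \<Longrightarrow> w t \<ge> 0" "g \<in> borel_measurable borel"
  shows "(\<integral>x. g x \<partial>atomic_measure I w Y) = (\<Sum>t\<in>I. w t * g (Y t))"
  unfolding atomic_measure_def using assms
  by (subst integral_distr) (auto simp: lebesgue_integral_point_measure_finite)

lemma prob_space_atomic_measure:
  assumes "finite I" "\<And>t. t \<in> I \<Longrightarrow> w t \<ge> 0" "sum w I = 1"
  shows "prob_space (atomic_measure I w Y)"
proof
  have "emeasure (atomic_measure I w Y) (space (atomic_measure I w Y))
      = (\<integral>\<^sup>+x. 1 \<partial>atomic_measure I w Y)"
    by simp
  also have "\<dots> = (\<Sum>t\<in>I. ennreal (w t) * 1)"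
    using assms by (intro nn_integral_atomic_measure) auto
  also have "\<dots> = 1"
    using assms by simp
  finally show "emeasure (atomic_measure I w Y) (space (atomic_measure I w Y)) = 1" .
qed

lemma empirical_eq_atomic_measure:
  assumes "n \<ge> 1"
  shows "empirical n X = atomic_measure {..<n} (\<lambda>_. 1 / n) X"
  using assms
  by (simp add: empirical_def atomic_measure_def uniform_count_measure_def divide_ennreal[symmetric])

section \<open>Divergence of the empirical measure from its completed reweighting\<close>

lemma sum_indicator_singleton_mult:
  fixes F :: "'a \<Rightarrow> real"
  assumes "finite S" "y \<in> S"
  shows "(\<Sum>x\<in>S. indicator {y} x * F x) = F y"
  using assms by (simp add: indicator_def if_distrib[where f="\<lambda>c. c * _"] sum.delta' cong: if_cong)

text \<open>At a sample the density of the empirical measure is the value of \<open>h\<close>,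
  except that the extra atom \<open>Y n\<close> may fall on a sample. This adds mass to the
  reference measure and lowers the density, hence only an inequality.\<close>

lemma KL_empirical_le:
  fixes X Y :: "nat \<Rightarrow> real" and h :: "real \<Rightarrow> real"
  assumes n: "n \<ge> 1"
    and h: "\<And>t. t < n \<Longrightarrow> h (X t) > 0"
    and w: "\<And>t. t < n \<Longrightarrow> w t = 1 / (n * h (X t))" "\<And>t. t \<le> n \<Longrightarrow> w t \<ge> 0" "(\<Sum>t\<le>n. w t) = 1"
    and Y: "\<And>t. t < n \<Longrightarrow> Y t = X t"
  shows "KL (empirical n X) (atomic_measure {..n} w Y) \<le> ereal ((\<Sum>t<n. ln (h (X t))) / n)"
proof -
  let ?\<eta> = "empirical n X" and ?\<kappa> = "atomic_measure {..n} w Y"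
  note \<eta>_eq = empirical_eq_atomic_measure[OF n, of X]
  interpret \<kappa>: prob_space ?\<kappa>
    using w by (intro prob_space_atomic_measure) auto
  \<comment> \<open>Point masses of the two measures, with ties summed, and their ratio
    \<open>g\<close>, the candidate density.\<close>
  define E W g :: "real \<Rightarrow> real" where
    "E x = (\<Sum>t<n. 1 / n * indicator {X t} x)" and
    "W x = (\<Sum>t\<le>n. w t * indicator {Y t} x)" and "g x = E x / W x" for x
  have [measurable]: "E \<in> borel_measurable borel" "W \<in> borel_measurable borel"
    "g \<in> borel_measurable borel"
    unfolding E_def[abs_def] W_def[abs_def] g_def[abs_def] by measurable
  have E_nonneg: "E x \<ge> 0" and W_nonneg: "W x \<ge> 0" for x
    using w(2) by (auto simp: E_def W_def intro!: sum_nonneg)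
  have g_nonneg: "g x \<ge> 0" for x
    using E_nonneg W_nonneg by (simp add: g_def)
  have E_pos: "E (X t) > 0" if "t < n" for t
  proof -
    have "0 < 1 / n * (indicator {X t} (X t) :: real)"
      using n by simp
    also have "\<dots> \<le> E (X t)"
      unfolding E_def using that by (intro member_le_sum) auto
    finally show ?thesis .
  qed
  have E_le: "E (X t) \<le> h (X t) * W (X t)" if "t < n" for t
  proof -
    have "E (X t) = h (X t) * (\<Sum>s<n. w s * indicator {Y s} (X t))"
      unfolding E_def sum_distrib_left
    proof (intro sum.cong refl)
      fix s assume "s \<in> {..<n}"
      then show "1 / n * indicator {X s} (X t) = h (X t) * (w s * indicator {Y s} (X t))"
        using h[of s] w(1)[of s] Y[of s] by (auto simp: indicator_def)
    qed
    also have "\<dots> \<le> h (X t) * W (X t)"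
      unfolding W_def using h[OF that] w(2) by (intro mult_left_mono sum_mono2) auto
    finally show ?thesis .
  qed
  have W_pos: "W (X t) > 0" if "t < n" for t
    using E_pos[OF that] E_le[OF that] h[OF that] by (smt (verit) mult_nonneg_nonpos)
  \<comment> \<open>Division by zero yields 0, so this makes \<open>W x * g x = E x\<close> true at
    every \<open>x\<close>.\<close>
  have W_0: "E x = 0" if "W x = 0" for x
    using W_pos that by (fastforce simp: E_def indicator_def intro!: sum.neutral)
  \<comment> \<open>Integrating \<open>g * a\<close> against \<open>?\<kappa>\<close> is integrating
    \<open>a\<close> against \<open>?\<eta>\<close>: both sums are regrouped by distinct
    locations.\<close>
  have change: "(\<Sum>t\<le>n. w t * (g (Y t) * a (Y t))) = (\<Sum>t<n. 1 / n * a (X t))" for a :: "real \<Rightarrow> real"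
  proof -
    let ?S = "Y ` {..n}"
    have "(\<Sum>t\<le>n. w t * (g (Y t) * a (Y t)))
        = (\<Sum>t\<le>n. w t * (\<Sum>x\<in>?S. indicator {Y t} x * (g x * a x)))"
      by (intro sum.cong arg_cong2[where f="(*)"] refl sum_indicator_singleton_mult[symmetric]) auto
    also have "\<dots> = (\<Sum>x\<in>?S. W x * (g x * a x))"
      unfolding W_def sum_distrib_left sum_distrib_right by (subst sum.swap) (simp add: mult_ac)
    also have "\<dots> = (\<Sum>x\<in>?S. E x * a x)"
      using W_0 by (intro sum.cong) (auto simp: g_def)
    also have "\<dots> = (\<Sum>t<n. 1 / n * (\<Sum>x\<in>?S. indicator {X t} x * a x))"
      unfolding E_def sum_distrib_left sum_distrib_right by (subst sum.swap) (simp add: mult_ac)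
    also have "\<dots> = (\<Sum>t<n. 1 / n * a (X t))"
    proof (intro sum.cong arg_cong2[where f="(*)"] refl sum_indicator_singleton_mult)
      fix t assume "t \<in> {..<n}"
      then show "X t \<in> ?S"
        using Y[of t] by (intro image_eqI[of _ _ t]) auto
    qed simp
    finally show ?thesis .
  qed
  have density: "density ?\<kappa> (\<lambda>x. ennreal (g x)) = ?\<eta>"
  proof (rule measure_eqI)
    show "sets (density ?\<kappa> (\<lambda>x. ennreal (g x))) = sets ?\<eta>"
      by (simp add: \<eta>_eq sets_atomic_measure)
    fix A assume "A \<in> sets (density ?\<kappa> (\<lambda>x. ennreal (g x)))"
    then have A [measurable]: "A \<in> sets borel"
      by (simp add: sets_atomic_measure)
    have "emeasure (density ?\<kappa> (\<lambda>x. ennreal (g x))) A = (\<integral>\<^sup>+x. ennreal (g x * indicator A x) \<partial>?\<kappa>)"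
      by (subst emeasure_density) (auto simp: sets_atomic_measure ennreal_mult'' ennreal_indicator)
    also have "\<dots> = (\<Sum>t\<le>n. ennreal (w t) * ennreal (g (Y t) * indicator A (Y t)))"
      by (intro nn_integral_atomic_measure) auto
    also have "\<dots> = ennreal (\<Sum>t\<le>n. w t * (g (Y t) * indicator A (Y t)))"
      using w(2) g_nonneg by (subst sum_ennreal[symmetric]) (auto simp: ennreal_mult)
    also have "\<dots> = ennreal (\<Sum>t<n. 1 / n * indicator A (X t))"
      by (simp only: change)
    also have "\<dots> = (\<Sum>t<n. ennreal (1 / n) * ennreal (indicator A (X t)))"
      by (intro sum_ennreal[symmetric, THEN trans] sum.cong refl ennreal_mult) auto
    also have "\<dots> = (\<integral>\<^sup>+x. ennreal (indicator A x) \<partial>?\<eta>)"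
      unfolding \<eta>_eq by (rule nn_integral_atomic_measure[symmetric]) auto
    also have "\<dots> = emeasure ?\<eta> A"
      by (simp add: \<eta>_eq sets_atomic_measure ennreal_indicator)
    finally show "emeasure (density ?\<kappa> (\<lambda>x. ennreal (g x))) A = emeasure ?\<eta> A" .
  qed
  have ac: "absolutely_continuous ?\<kappa> ?\<eta>"
    unfolding density[symmetric] by (intro absolutely_continuousI_density) simp
  \<comment> \<open>Uniqueness holds almost everywhere for \<open>?\<kappa>\<close>; absolute
    continuity carries it to \<open>?\<eta>\<close>, against which the logarithm is
    integrated.\<close>
  have "AE x in ?\<kappa>. ennreal (g x) = RN_deriv ?\<kappa> ?\<eta> x"
    by (rule \<kappa>.RN_deriv_unique[OF _ density]) simp
  then have "AE x in ?\<eta>. ennreal (g x) = RN_deriv ?\<kappa> ?\<eta> x"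
    using ac by (intro absolutely_continuous_AE[where M="?\<kappa>" and M'="?\<eta>"])
      (auto simp: \<eta>_eq sets_atomic_measure)
  then have AE: "AE x in ?\<eta>. ln (enn2real (RN_deriv ?\<kappa> ?\<eta> x)) = ln (g x)"
    by eventually_elim (metis enn2real_ennreal g_nonneg)
  have sets_\<eta> [measurable_cong]: "sets ?\<eta> = sets borel"
    by (simp add: \<eta>_eq sets_atomic_measure)
  have [measurable]: "RN_deriv ?\<kappa> ?\<eta> \<in> borel_measurable borel"
    using borel_measurable_RN_deriv[of ?\<kappa> ?\<eta>] measurable_cong_sets[OF sets_atomic_measure refl] by blast
  have "integrable ?\<eta> (\<lambda>x. ln (g x))"
    unfolding \<eta>_eq by (intro integrable_atomic_measure) auto
  then have int: "integrable ?\<eta> (\<lambda>x. ln (enn2real (RN_deriv ?\<kappa> ?\<eta> x)))"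
    by (rule integrable_cong_AE_imp) (use AE in \<open>auto elim: eventually_mono\<close>)
  have "(\<integral>x. ln (enn2real (RN_deriv ?\<kappa> ?\<eta> x)) \<partial>?\<eta>) = (\<integral>x. ln (g x) \<partial>?\<eta>)"
    using AE by (intro integral_cong_AE) auto
  also have "\<dots> = (\<Sum>t<n. 1 / n * ln (g (X t)))"
    unfolding \<eta>_eq by (intro integral_atomic_measure) auto
  also have "\<dots> \<le> (\<Sum>t<n. 1 / n * ln (h (X t)))"
  proof (intro sum_mono mult_left_mono)
    fix t assume "t \<in> {..<n}"
    then have t: "t < n" by simp
    have "0 < g (X t)" "g (X t) \<le> h (X t)"
      using E_pos[OF t] W_pos[OF t] E_le[OF t] by (auto simp: g_def field_simps)
    then show "ln (g (X t)) \<le> ln (h (X t))"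
      by simp
  qed simp
  also have "\<dots> = (\<Sum>t<n. ln (h (X t))) / n"
    by (simp add: sum_divide_distrib)
  finally show ?thesis
    using ac int by (simp add: KL_def)
qed

section \<open>Averages over a convex region\<close>

lemma emeasure_shrunk_copy:
  fixes S :: "'a::euclidean_space set"
  assumes "S \<in> sets borel" "s > 0"
  shows "emeasure lborel {x. (1 / s) *\<^sub>R (x - a) \<in> S} = ennreal (s ^ DIM('a)) * emeasure lborel S"
proof -
  have "{x. (1 / s) *\<^sub>R (x - a) \<in> S} = (\<lambda>x. s *\<^sub>R x + a) ` S"
    using assms(2) by (force simp: image_iff)
  moreover have "{x. (1 / s) *\<^sub>R (x - a) \<in> S} \<in> sets borel"
    using assms(1) by measurable
  ultimately show ?thesis
    using emeasure_lebesgue_affine[of s a S] assms by simp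
qed

text \<open>This is \<open>n\<close> times a Beta integral; the antiderivative \<open>F\<close>
  comes from integrating by parts twice.\<close>

lemma nn_integral_beta_weight:
  "(\<integral>\<^sup>+s. ennreal (real n * (1 - s) ^ (n - 1) * s\<^sup>2) * indicator {0..1} s \<partial>lborel)
     = ennreal (2 / ((real n + 1) * (real n + 2)))" if "n \<ge> 1" for n :: nat
proof -
  define F where "F s = - ((1 - s) ^ n * s\<^sup>2) - 2 * s * (1 - s) ^ (n + 1) / (real n + 1)
    - 2 * (1 - s) ^ (n + 2) / ((real n + 1) * (real n + 2))" for s :: real
  have "(F has_real_derivative real n * (1 - s) ^ (n - 1) * s\<^sup>2) (at s)" for s
  proof -
    have cancel: "2 * (- (c * p)) / (b * c) = - (2 * p / b)" if "c \<noteq> 0" for b c p :: real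
      using that by (simp add: field_simps)
    have pow: "((\<lambda>s. (1 - s) ^ k) has_real_derivative - (k * (1 - s) ^ (k - 1))) (at s)" for k
      by (auto intro!: derivative_eq_intros)
    have "(F has_real_derivative
        - (- (n * (1 - s) ^ (n - 1)) * s\<^sup>2 + 2 * s * (1 - s) ^ n)
        - (2 * (1 - s) ^ (n + 1) + - (real (n + 1) * (1 - s) ^ (n + 1 - 1)) * (2 * s)) / (real n + 1)
        - 2 * (- (real (n + 2) * (1 - s) ^ (n + 2 - 1))) / ((real n + 1) * (real n + 2))) (at s)"
      unfolding F_def
      by (intro DERIV_diff DERIV_minus DERIV_mult DERIV_cdivide DERIV_cmult pow)
        (auto intro!: derivative_eq_intros)
    moreover have "(2 * (1 - s) ^ (n + 1) + - (real (n + 1) * (1 - s) ^ (n + 1 - 1)) * (2 * s)) / (real n + 1)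
        = 2 * (1 - s) ^ (n + 1) / (real n + 1) - 2 * s * (1 - s) ^ n"
      by (simp add: field_simps)
    moreover have "2 * (- (real (n + 2) * (1 - s) ^ (n + 2 - 1))) / ((real n + 1) * (real n + 2))
        = - (2 * (1 - s) ^ (n + 1) / (real n + 1))"
      using cancel[of "real n + 2" "(1 - s) ^ (n + 1)" "real n + 1"] by (simp add: add.commute)
    ultimately show ?thesis
      by simp
  qed
  then have "(\<integral>\<^sup>+s. ennreal (real n * (1 - s) ^ (n - 1) * s\<^sup>2) * indicator {0..1} s \<partial>lborel) = ennreal (F 1 - F 0)"
    by (intro nn_integral_FTC_Icc) auto
  also have "F 1 - F 0 = 2 / ((real n + 1) * (real n + 2))"
    using that by (simp add: F_def)
  finally show ?thesis .
qed

lemma nn_integral_power_weight: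
  assumes "n \<ge> 1" "0 \<le> c" "c \<le> 1"
  shows "(\<integral>\<^sup>+s. ennreal (real n * (1 - s) ^ (n - 1)) * indicator {c..1} s \<partial>lborel) = ennreal ((1 - c) ^ n)"
proof -
  have "(\<integral>\<^sup>+s. ennreal (real n * (1 - s) ^ (n - 1)) * indicator {c..1} s \<partial>lborel)
      = ennreal (- ((1 - 1) ^ n) - (- ((1 - c) ^ n)))"
    using assms
    by (intro nn_integral_FTC_Icc) (auto intro!: derivative_eq_intros)
  then show ?thesis
    using assms by simp
qed

text \<open>Copies \<open>(1 - s) a + s R\<close> of the region, on which \<open>q\<close> is at least \<open>(1 - s)\<^sup>n q a\<close> and whose area
  is \<open>s\<^sup>2\<close> times that of \<open>R\<close>, are averaged against the density \<open>n (1 - s)\<^sup>n\<^sup>-\<^sup>1\<close> of \<open>s\<close>.\<close>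
lemma mixture_lower_bound:
  fixes R :: "(real \<times> real) set" and q :: "real \<times> real \<Rightarrow> real"
  assumes n: "n \<ge> 1" and R [measurable]: "R \<in> sets borel" and q [measurable]: "q \<in> borel_measurable borel"
    and q_nonneg: "\<And>b. b \<in> R \<Longrightarrow> q b \<ge> 0" and q_a: "q a > 0"
    and copy: "\<And>b s. b \<in> R \<Longrightarrow> 0 \<le> s \<Longrightarrow> s \<le> 1 \<Longrightarrow> (1 - s) *\<^sub>R a + s *\<^sub>R b \<in> R"
    and decay: "\<And>b s. b \<in> R \<Longrightarrow> 0 \<le> s \<Longrightarrow> s \<le> 1 \<Longrightarrow> (1 - s) ^ n * q a \<le> q ((1 - s) *\<^sub>R a + s *\<^sub>R b)"
  shows "ennreal (2 / ((real n + 1) * (real n + 2)) * q a) * emeasure lborel R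
    \<le> (\<integral>\<^sup>+x. ennreal (q x) * indicator R x \<partial>lborel)"
proof -
  \<comment> \<open>The weight omits \<open>s = 0\<close>, so that for every \<open>s\<close> it
    charges, \<open>J s\<close> below is the indicator of the copy
    \<open>(1 - s) a + s R\<close>.\<close>
  define v :: "real \<Rightarrow> ennreal" where "v s = ennreal (real n * (1 - s) ^ (n - 1)) * indicator {0<..1} s" for s
  have [measurable]: "v \<in> borel_measurable borel"
    unfolding v_def[abs_def] by measurable
  define J :: "real \<Rightarrow> real \<times> real \<Rightarrow> ennreal" where
    "J s x = indicator R ((1 / s) *\<^sub>R (x - (1 - s) *\<^sub>R a))" for s x
  have [measurable]: "case_prod J \<in> borel_measurable (lborel \<Otimes>\<^sub>M lborel)"
    unfolding J_def[abs_def] by measurable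
  \<comment> \<open>The total weight of the copies containing \<open>x\<close>: membership forces
    \<open>(1 - s) ^ n \<le> q x / q a\<close>, that is \<open>s \<ge> c\<close>, and the tail from
    \<open>c\<close> on weighs \<open>(1 - c) ^ n\<close>.\<close>
  have inner: "(\<integral>\<^sup>+s. v s * J s x \<partial>lborel) \<le> ennreal (q x / q a) * indicator R x" for x
  proof (cases "x \<in> R")
    case False
    have "v s * J s x = 0" for s
    proof (rule ccontr)
      assume "v s * J s x \<noteq> 0"
      then have s: "0 < s" "s \<le> 1" and b: "(1 / s) *\<^sub>R (x - (1 - s) *\<^sub>R a) \<in> R"
        by (auto simp: v_def J_def indicator_def split: if_splits)
      then show False
        using copy[OF b, of s] False by simp
    qed
    then have "(\<lambda>s. v s * J s x) = (\<lambda>_. 0)" by (intro ext)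
    then show ?thesis by (simp only: nn_integral_const) simp
  next
    case True
    define c where "c = 1 - min 1 (root n (q x / q a))"
    have root: "0 \<le> root n (q x / q a)"
      using q_nonneg[OF True] q_a n by simp
    have c: "0 \<le> c" "c \<le> 1"
      using root by (auto simp: c_def)
    have "v s * J s x \<le> ennreal (real n * (1 - s) ^ (n - 1)) * indicator {c..1} s" for s
    proof (cases "v s * J s x = 0")
      case False
      then have s: "0 < s" "s \<le> 1" and b: "(1 / s) *\<^sub>R (x - (1 - s) *\<^sub>R a) \<in> R"
        by (auto simp: v_def J_def indicator_def split: if_splits)
      then have "(1 - s) ^ n \<le> q x / q a"
        using decay[OF b, of s] q_a by (simp add: field_simps)
      then have "root n ((1 - s) ^ n) \<le> root n (q x / q a)"
        using n by (intro real_root_le_mono) auto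
      then have "c \<le> s"
        using s n by (simp add: c_def real_root_power_cancel)
      then show ?thesis
        using s b by (simp add: v_def J_def)
    next
      case True
      then show ?thesis by (simp only:) simp
    qed
    then have "(\<integral>\<^sup>+s. v s * J s x \<partial>lborel)
        \<le> (\<integral>\<^sup>+s. ennreal (real n * (1 - s) ^ (n - 1)) * indicator {c..1} s \<partial>lborel)"
      by (intro nn_integral_mono)
    also have "\<dots> = ennreal ((1 - c) ^ n)"
      by (rule nn_integral_power_weight[OF n c])
    also have "\<dots> \<le> ennreal (root n (q x / q a) ^ n)"
      using root by (intro ennreal_leI power_mono) (auto simp: c_def)
    also have "root n (q x / q a) ^ n = q x / q a"
      using n q_nonneg[OF True] q_a by (intro real_root_pow_pos2) auto
    finally show ?thesis
      using True by simp
  qed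
  \<comment> \<open>The integral of \<open>v s * J s x\<close> over both variables, with
    \<open>x\<close> first: the area of a copy supplies the square of \<open>s\<close> in the Beta
    integral. Exchanging the order brings in \<open>inner\<close>.\<close>
  have "ennreal (2 / ((real n + 1) * (real n + 2))) * emeasure lborel R
      = (\<integral>\<^sup>+s. ennreal (real n * (1 - s) ^ (n - 1) * s\<^sup>2) * indicator {0..1} s * emeasure lborel R \<partial>lborel)"
    unfolding nn_integral_beta_weight[OF n, symmetric]
    by (rule nn_integral_multc[symmetric]) measurable
  also have "\<dots> = (\<integral>\<^sup>+s. (\<integral>\<^sup>+x. v s * J s x \<partial>lborel) \<partial>lborel)"
  proof (intro nn_integral_cong)
    fix s :: real
    show "ennreal (real n * (1 - s) ^ (n - 1) * s\<^sup>2) * indicator {0..1} s * emeasure lborel R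
        = (\<integral>\<^sup>+x. v s * J s x \<partial>lborel)"
    proof (cases "0 < s \<and> s \<le> 1")
      case True
      have "(\<integral>\<^sup>+x. J s x \<partial>lborel) = (\<integral>\<^sup>+x. indicator {x. (1 / s) *\<^sub>R (x - (1 - s) *\<^sub>R a) \<in> R} x \<partial>lborel)"
        by (intro nn_integral_cong) (simp add: J_def indicator_def)
      also have "\<dots> = emeasure lborel {x. (1 / s) *\<^sub>R (x - (1 - s) *\<^sub>R a) \<in> R}"
        by (intro nn_integral_indicator) measurable
      also have "\<dots> = ennreal (s\<^sup>2) * emeasure lborel R"
        using True by (subst emeasure_shrunk_copy) (auto simp: power2_eq_square)
      finally have "(\<integral>\<^sup>+x. v s * J s x \<partial>lborel) = v s * (ennreal (s\<^sup>2) * emeasure lborel R)"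
        by (subst nn_integral_cmult) auto
      then show ?thesis
        using True by (simp add: v_def ennreal_mult mult.assoc)
    next
      case False
      then show ?thesis
        by (auto simp: v_def indicator_def)
    qed
  qed
  also have "\<dots> = (\<integral>\<^sup>+x. (\<integral>\<^sup>+s. v s * J s x \<partial>lborel) \<partial>lborel)"
    by (rule lborel_pair.Fubini'[symmetric]) measurable
  also have "\<dots> \<le> (\<integral>\<^sup>+x. ennreal (q x / q a) * indicator R x \<partial>lborel)"
    by (intro nn_integral_mono inner)
  finally have "ennreal (q a) * (ennreal (2 / ((real n + 1) * (real n + 2))) * emeasure lborel R)
      \<le> ennreal (q a) * (\<integral>\<^sup>+x. ennreal (q x / q a) * indicator R x \<partial>lborel)"
    by (rule mult_left_mono) simp
  also have "\<dots> = (\<integral>\<^sup>+x. ennreal (q a) * (ennreal (q x / q a) * indicator R x) \<partial>lborel)"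
    by (rule nn_integral_cmult[symmetric]) measurable
  also have "\<dots> = (\<integral>\<^sup>+x. ennreal (q x) * indicator R x \<partial>lborel)"
  proof (intro nn_integral_cong)
    fix x show "ennreal (q a) * (ennreal (q x / q a) * indicator R x) = ennreal (q x) * indicator R x"
      using q_a q_nonneg[of x] by (cases "x \<in> R") (auto simp: ennreal_mult[symmetric])
  qed
  finally show ?thesis
    using q_a by (subst mult.commute[of _ "q a"], subst ennreal_mult) (simp_all only: mult.assoc, auto)
qed

section \<open>The deviation bound\<close>

context moment_constraint
begin

text \<open>The completing atom takes index \<open>n\<close>. As the weights sum to 1, the centred
  inequalities of \<open>dual_optimum\<close> become the two moment constraints.\<close>

lemma feasible_reweighting:
  fixes X :: "nat \<Rightarrow> real" and n :: nat
  assumes "n \<ge> 1"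
  obtains \<theta> w Y where "\<theta> \<in> R" "\<And>t. t < n \<Longrightarrow> L \<theta> (X t) > 0"
    "\<And>t. t < n \<Longrightarrow> w t = 1 / (real n * L \<theta> (X t))" "\<And>t. t < n \<Longrightarrow> Y t = X t"
    "\<And>t. t \<le> n \<Longrightarrow> w t \<ge> 0" "(\<Sum>t\<le>n. w t) = 1"
    "m \<le> (\<Sum>t\<le>n. w t * Y t)" "(\<Sum>t\<le>n. w t * \<phi> (Y t)) \<le> B"
proof -
  obtain \<theta> \<delta> y where \<theta>: "\<theta> \<in> R" "\<And>t. t < n \<Longrightarrow> L \<theta> (X t) > 0" "\<delta> \<ge> 0"
    and 1: "\<delta> + (\<Sum>t<n. 1 / (real n * L \<theta> (X t))) = 1"
    and 2: "(\<Sum>t<n. 1 / (real n * L \<theta> (X t)) * (X t - m)) + \<delta> * (y - m) \<ge> 0"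
    and 3: "(\<Sum>t<n. 1 / (real n * L \<theta> (X t)) * (B - \<phi> (X t))) + \<delta> * (B - \<phi> y) \<ge> 0"
    using dual_optimum[OF assms, of X] by blast
  define w where "w t = (if t < n then 1 / (real n * L \<theta> (X t)) else \<delta>)" for t
  define Y where "Y t = (if t < n then X t else y)" for t
  have split: "(\<Sum>t\<le>n. w t * F (Y t)) = (\<Sum>t<n. 1 / (real n * L \<theta> (X t)) * F (X t)) + \<delta> * F y" for F
    by (simp add: lessThan_Suc_atMost[symmetric] w_def Y_def)
  have w: "(\<Sum>t\<le>n. w t) = 1"
    using split[of "\<lambda>_. 1"] 1 by simp
  have "(\<Sum>t\<le>n. w t * (Y t - m)) \<ge> 0" "(\<Sum>t\<le>n. w t * (B - \<phi> (Y t))) \<ge> 0"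
    using 2 3 split[of "\<lambda>x. x - m"] split[of "\<lambda>x. B - \<phi> x"] by simp_all
  then have "m \<le> (\<Sum>t\<le>n. w t * Y t)" "(\<Sum>t\<le>n. w t * \<phi> (Y t)) \<le> B"
    using w by (simp_all add: right_diff_distrib sum_subtractf sum_distrib_right[symmetric])
  then show ?thesis
    using \<theta> w by (intro that[of \<theta> w Y]) (auto simp: w_def Y_def less_imp_le)
qed

section \<open>Reflection at the origin\<close>

lemma moment_constraint_uminus: "moment_constraint \<phi> B (- m)"
  using convex even superlinear mean_interior by unfold_locales auto

lemma lagrangian_uminus: "lagrangian \<phi> B (- m) \<theta> (- y) = L (- fst \<theta>, snd \<theta>) y"
  using even by (simp add: lagrangian_def algebra_simps)

lemma dual_region_uminus:
  assumes "\<theta> \<in> dual_region \<phi> B (- m)"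
  shows "(- fst \<theta>, snd \<theta>) \<in> R"
  using assms by (auto simp: dual_region_def lagrangian_uminus[symmetric])

end

lemma mean_atomic_measure:
  assumes "finite I" "\<And>t. t \<in> I \<Longrightarrow> w t \<ge> 0"
  shows "mean (atomic_measure I w Y) = (\<Sum>t\<in>I. w t * Y t)"
  unfolding mean_def using assms by (intro integral_atomic_measure) auto

lemma atomic_measure_in_Lclass:
  assumes "finite I" "\<And>t. t \<in> I \<Longrightarrow> w t \<ge> 0" "sum w I = 1"
    and [measurable]: "(\<lambda>y. f \<bar>y\<bar>) \<in> borel_measurable borel" and "\<And>y. f \<bar>y\<bar> \<ge> 0"
    and "(\<Sum>t\<in>I. w t * f \<bar>Y t\<bar>) \<le> B"
  shows "atomic_measure I w Y \<in> Lclass f B"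
proof -
  have "(\<integral>\<^sup>+x. ennreal (f \<bar>x\<bar>) \<partial>atomic_measure I w Y) = (\<Sum>t\<in>I. ennreal (w t) * ennreal (f \<bar>Y t\<bar>))"
    using assms(1) by (intro nn_integral_atomic_measure) auto
  also have "\<dots> = ennreal (\<Sum>t\<in>I. w t * f \<bar>Y t\<bar>)"
    using assms(2,5) by (subst sum_ennreal[symmetric]) (auto simp: ennreal_mult)
  also have "\<dots> \<le> ennreal B"
    using assms(6) by (rule ennreal_leI)
  finally show ?thesis
    using assms(1-3)
    by (auto simp: Lclass_def Pfin_def sets_atomic_measure
        intro!: prob_space_atomic_measure integrable_atomic_measure)
qed

text \<open>The completed reweighting is one competitor in the infimum, and
  \<open>KL_empirical_le\<close> bounds its divergence.\<close>

lemma KLinf_empirical_le_dual: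
  fixes X :: "nat \<Rightarrow> real" and n :: nat
  assumes "moment_constraint (\<lambda>y. f \<bar>y\<bar>) B m" and n: "n \<ge> 1"
    and meas: "(\<lambda>y. f \<bar>y\<bar>) \<in> borel_measurable borel" and nonneg: "\<And>y. f \<bar>y\<bar> \<ge> 0"
  obtains \<theta> where "\<theta> \<in> dual_region (\<lambda>y. f \<bar>y\<bar>) B m"
    "\<And>t. t < n \<Longrightarrow> lagrangian (\<lambda>y. f \<bar>y\<bar>) B m \<theta> (X t) > 0"
    "KLinf f B (empirical n X) m \<le> ereal ((\<Sum>t<n. ln (lagrangian (\<lambda>y. f \<bar>y\<bar>) B m \<theta> (X t))) / n)"
proof -
  interpret moment_constraint "\<lambda>y. f \<bar>y\<bar>" B m by fact
  show ?thesis
  proof (cases "mean (empirical n X) \<le> m")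
    case True
    obtain \<theta> w Y where *: "\<theta> \<in> R" "\<And>t. t < n \<Longrightarrow> L \<theta> (X t) > 0"
      "\<And>t. t < n \<Longrightarrow> w t = 1 / (real n * L \<theta> (X t))" "\<And>t. t < n \<Longrightarrow> Y t = X t"
      "\<And>t. t \<le> n \<Longrightarrow> w t \<ge> 0" "(\<Sum>t\<le>n. w t) = 1"
      "m \<le> (\<Sum>t\<le>n. w t * Y t)" "(\<Sum>t\<le>n. w t * f \<bar>Y t\<bar>) \<le> B"
      using feasible_reweighting[OF n, of X] by blast
    have "atomic_measure {..n} w Y \<in> Lclass f B"
      using *(5,6,8) by (intro atomic_measure_in_Lclass meas nonneg) auto
    moreover have "m \<le> mean (atomic_measure {..n} w Y)"
      using *(5,7) by (subst mean_atomic_measure) auto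
    ultimately have "KLinf f B (empirical n X) m \<le> KL (empirical n X) (atomic_measure {..n} w Y)"
      unfolding KLinf_def if_P[OF True] by (intro INF_lower) simp
    also have "\<dots> \<le> ereal ((\<Sum>t<n. ln (L \<theta> (X t))) / n)"
      using n * by (intro KL_empirical_le) auto
    finally show ?thesis
      using * that by blast
  next
    case False
    \<comment> \<open>Reflecting the samples and \<open>m\<close> reduces this branch to the
      reweighting already constructed; the atoms are then reflected back.\<close>
    interpret neg: moment_constraint "\<lambda>y. f \<bar>y\<bar>" B "- m"
      by (rule moment_constraint_uminus)
    obtain \<theta> w Y where *: "\<theta> \<in> neg.R" "\<And>t. t < n \<Longrightarrow> neg.L \<theta> (- X t) > 0"
      "\<And>t. t < n \<Longrightarrow> w t = 1 / (real n * neg.L \<theta> (- X t))" "\<And>t. t < n \<Longrightarrow> Y t = - X t"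
      "\<And>t. t \<le> n \<Longrightarrow> w t \<ge> 0" "(\<Sum>t\<le>n. w t) = 1"
      "- m \<le> (\<Sum>t\<le>n. w t * Y t)" "(\<Sum>t\<le>n. w t * f \<bar>Y t\<bar>) \<le> B"
      using neg.feasible_reweighting[OF n, of "\<lambda>t. - X t"] by blast
    \<comment> \<open>As \<open>\<phi>\<close> is even, reflection flips the sign of the first
      multiplier only, and \<open>R\<close> admits both signs.\<close>
    let ?\<theta> = "(- fst \<theta>, snd \<theta>)"
    have "atomic_measure {..n} w (\<lambda>t. - Y t) \<in> Lclass f B"
      using *(5,6,8) by (intro atomic_measure_in_Lclass meas nonneg) auto
    moreover have "mean (atomic_measure {..n} w (\<lambda>t. - Y t)) \<le> m"
      using *(5,7) by (subst mean_atomic_measure) (auto simp: sum_negf)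
    ultimately have "KLinf f B (empirical n X) m \<le> KL (empirical n X) (atomic_measure {..n} w (\<lambda>t. - Y t))"
      unfolding KLinf_def if_not_P[OF False] by (intro INF_lower) simp
    also have "\<dots> \<le> ereal ((\<Sum>t<n. ln (L ?\<theta> (X t))) / n)"
      using n * by (intro KL_empirical_le) (auto simp: lagrangian_uminus)
    finally show ?thesis
      using * dual_region_uminus by (intro that[of ?\<theta>]) (auto simp: lagrangian_uminus)
  qed
qed

text \<open>The linear term is centred at the mean and integrates to 0; the moment term is
  subtracted with a non-negative expectation, as \<open>\<kappa>\<close> lies in the class.\<close>

lemma nn_integral_lagrangian_le_1:
  assumes \<kappa>: "\<kappa> \<in> Lclass f B" and B: "B \<ge> 0"
    and meas: "(\<lambda>y. f \<bar>y\<bar>) \<in> borel_measurable borel" and nonneg: "\<And>y. f \<bar>y\<bar> \<ge> 0"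
    and \<theta>: "\<theta> \<in> dual_region (\<lambda>y. f \<bar>y\<bar>) B (mean \<kappa>)"
  shows "(\<integral>\<^sup>+y. ennreal (lagrangian (\<lambda>y. f \<bar>y\<bar>) B (mean \<kappa>) \<theta> y) \<partial>\<kappa>) \<le> 1"
proof -
  interpret prob_space \<kappa>
    using \<kappa> by (simp add: Lclass_def Pfin_def)
  have [measurable_cong]: "sets \<kappa> = sets borel" and id: "integrable \<kappa> (\<lambda>x. x)"
    and le: "(\<integral>\<^sup>+x. ennreal (f \<bar>x\<bar>) \<partial>\<kappa>) \<le> ennreal B"
    using \<kappa> by (auto simp: Lclass_def Pfin_def)
  note meas [measurable]
  have f: "integrable \<kappa> (\<lambda>x. f \<bar>x\<bar>)"
    using le nonneg by (intro integrableI_nonneg) (auto simp: le_less_trans[OF _ ennreal_less_top])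
  have "ennreal (\<integral>x. f \<bar>x\<bar> \<partial>\<kappa>) \<le> ennreal B"
    using le nn_integral_eq_integral[OF f] nonneg by simp
  then have fB: "(\<integral>x. f \<bar>x\<bar> \<partial>\<kappa>) \<le> B"
    using B by simp
  have "(\<integral>\<^sup>+y. ennreal (lagrangian (\<lambda>y. f \<bar>y\<bar>) B (mean \<kappa>) \<theta> y) \<partial>\<kappa>)
      = ennreal (\<integral>y. lagrangian (\<lambda>y. f \<bar>y\<bar>) B (mean \<kappa>) \<theta> y \<partial>\<kappa>)"
    using \<theta> id f by (intro nn_integral_eq_integral) (auto simp: lagrangian_def dual_region_def)
  also have "(\<integral>y. lagrangian (\<lambda>y. f \<bar>y\<bar>) B (mean \<kappa>) \<theta> y \<partial>\<kappa>)
      = 1 - fst \<theta> * (mean \<kappa> - mean \<kappa>) - snd \<theta> * (B - (\<integral>x. f \<bar>x\<bar> \<partial>\<kappa>))"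
    unfolding lagrangian_def using id f by (simp add: prob_space mean_def)
  also have "\<dots> \<le> 1"
    using \<theta> fB by (simp add: dual_region_def)
  finally show ?thesis
    by (simp add: ennreal_leI)
qed


text \<open>Monotonicity of \<open>f\<close> turns the triangle inequality into convexity on the
  whole line. The growth bound holds eventually; on the remaining bounded range the constant
  \<open>\<bar>A\<bar> * N'\<close> works because \<open>f\<close> is non-negative.\<close>

lemma moment_constraint_abs:
  assumes f_mono: "strict_mono_on {0..} f"
    and f_nonneg: "\<And>y. y \<ge> 0 \<Longrightarrow> f y \<ge> 0"
    and f_convex: "convex_on {0..} f"
    and f_superlin: "filterlim (\<lambda>y. f y / y) at_top at_top"
    and "f \<bar>m\<bar> < B"
  shows "moment_constraint (\<lambda>y. f \<bar>y\<bar>) B m"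
proof
  show "convex_on UNIV (\<lambda>y. f \<bar>y\<bar>)"
  proof (rule convex_onI)
    fix t x y :: real assume t: "0 < t" "t < 1"
    have "\<bar>(1 - t) *\<^sub>R x + t *\<^sub>R y\<bar> \<le> (1 - t) * \<bar>x\<bar> + t * \<bar>y\<bar>"
      using t abs_triangle_ineq[of "(1 - t) * x" "t * y"] by (simp add: abs_mult)
    then have "f \<bar>(1 - t) *\<^sub>R x + t *\<^sub>R y\<bar> \<le> f ((1 - t) * \<bar>x\<bar> + t * \<bar>y\<bar>)"
      using t by (intro strict_mono_on_leD[OF f_mono]) simp_all
    also have "\<dots> \<le> (1 - t) * f \<bar>x\<bar> + t * f \<bar>y\<bar>"
      using convex_onD[OF f_convex, of t "\<bar>x\<bar>" "\<bar>y\<bar>"] t by simp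
    finally show "f \<bar>(1 - t) *\<^sub>R x + t *\<^sub>R y\<bar> \<le> (1 - t) * f \<bar>x\<bar> + t * f \<bar>y\<bar>" .
  qed simp
  show "\<exists>K. \<forall>y. A * \<bar>y\<bar> - K \<le> f \<bar>y\<bar>" for A
  proof -
    have "eventually (\<lambda>y. A \<le> f y / y) at_top"
      using f_superlin by (simp add: filterlim_at_top)
    then obtain N where N: "\<And>y. y \<ge> N \<Longrightarrow> A \<le> f y / y"
      by (auto simp: eventually_at_top_linorder)
    define N' where "N' = max N 1"
    have "A * \<bar>y\<bar> - \<bar>A\<bar> * N' \<le> f \<bar>y\<bar>" for y
    proof (cases "\<bar>y\<bar> \<ge> N'")
      case True
      then have "A * \<bar>y\<bar> \<le> f \<bar>y\<bar>"
        using N[of "\<bar>y\<bar>"] by (auto simp: N'_def field_simps)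
      moreover have "0 \<le> \<bar>A\<bar> * N'"
        by (simp add: N'_def)
      ultimately show ?thesis by linarith
    next
      case False
      have "A * \<bar>y\<bar> \<le> \<bar>A\<bar> * N'"
        using False by (intro mult_mono) auto
      then show ?thesis
        using f_nonneg[of "\<bar>y\<bar>"] by simp
    qed
    then show ?thesis by blast
  qed
qed (use assms in auto)

text \<open>Makes the first denominator in the exponent positive. The intermediate value theorem
  gives a preimage of \<open>B\<close>, and injectivity identifies it with
  \<open>finv f B\<close>.\<close>

lemma abs_less_finv:
  assumes f_mono: "strict_mono_on {0..} f"
    and f_cont: "continuous_on {0..} f"
    and f_superlin: "filterlim (\<lambda>y. f y / y) at_top at_top"
    and B: "B > 0" and m: "f \<bar>m\<bar> < B"
  shows "\<bar>m\<bar> < finv f B"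
proof -
  have "eventually (\<lambda>y. B \<le> f y / y) at_top"
    using f_superlin by (simp add: filterlim_at_top)
  then obtain N where N: "\<And>y. y \<ge> N \<Longrightarrow> B \<le> f y / y"
    by (auto simp: eventually_at_top_linorder)
  \<comment> \<open>\<open>y \<ge> N\<close> gives \<open>f y \<ge> B * y\<close>,
    \<open>y \<ge> 1\<close> gives \<open>B * y \<ge> B\<close>, and
    \<open>y \<ge> \<bar>m\<bar>\<close> makes room for the intermediate value theorem.\<close>
  define y where "y = max N (max 1 \<bar>m\<bar>)"
  have "y \<ge> 1" "y \<ge> \<bar>m\<bar>" by (auto simp: y_def)
  have "B \<le> B * y"
    using B \<open>y \<ge> 1\<close> by simp
  also have "\<dots> \<le> f y"
    using N[of y] \<open>y \<ge> 1\<close> by (simp add: y_def field_simps)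
  finally have "B \<le> f y" .
  then obtain z where z: "\<bar>m\<bar> \<le> z" "f z = B"
    using IVT'[of f "\<bar>m\<bar>" B y] m \<open>y \<ge> \<bar>m\<bar>\<close> continuous_on_subset[OF f_cont, of "{\<bar>m\<bar>..y}"] by auto
  have "finv f B = z"
    unfolding finv_def
  proof (rule the_equality)
    fix x assume "0 \<le> x \<and> f x = B"
    then show "x = z"
      using z strict_mono_on_imp_inj_on[OF f_mono] by (auto simp: inj_on_def)
  qed (use z in auto)
  then show ?thesis
    using z m by (cases "z = \<bar>m\<bar>") auto
qed

text \<open>The measurable cover \<open>A\<close> bounds the outer probability of the event, hence
  its probability whenever the event is measurable.\<close>

theorem theorem11:
  fixes f :: "real \<Rightarrow> real" and B u :: real and n :: nat and \<kappa> :: "real measure"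
  assumes f_mono: "strict_mono_on {0..} f"
    and f_cont: "continuous_on {0..} f"
    and f_nonneg: "\<And>y. y \<ge> 0 \<Longrightarrow> f y \<ge> 0"
    and f_convex: "convex_on {0..} f"
    and f_superlin: "filterlim (\<lambda>y. f y / y) at_top at_top"
    and B_pos: "B > 0"
    and kappa_L: "\<kappa> \<in> Lclass f B"
    and mean_lt: "f \<bar>mean \<kappa>\<bar> < B"
    and n_pos: "n \<ge> 1"
    and u_nonneg: "u \<ge> 0"
  shows "\<exists>A \<in> sets (PiM {..<n} (\<lambda>_. \<kappa>)).
           {X \<in> space (PiM {..<n} (\<lambda>_. \<kappa>)). KLinf f B (empirical n X) (mean \<kappa>) \<ge> ereal u} \<subseteq> A
         \<and> measure (PiM {..<n} (\<lambda>_. \<kappa>)) A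
             \<le> (real n + 1)^2
                * exp ((\<integral>x. \<bar>x - mean \<kappa>\<bar> \<partial>\<kappa>) / (2 * (finv f B - mean \<kappa>))
                     + (\<integral>x. \<bar>B - f \<bar>x\<bar>\<bar> \<partial>\<kappa>) / (2 * (B - f \<bar>mean \<kappa>\<bar>)))
                * exp (- real n * u)"
proof -
  define m where "m = mean \<kappa>"
  define P where "P = PiM {..<n} (\<lambda>_. \<kappa>)"
  let ?\<phi> = "\<lambda>y. f \<bar>y\<bar>"
  interpret moment_constraint ?\<phi> B m
    unfolding m_def using assms by (intro moment_constraint_abs)
  have \<phi>_nonneg: "?\<phi> y \<ge> 0" for y
    using f_nonneg by simp
  have \<phi>_meas [measurable]: "?\<phi> \<in> borel_measurable borel"
    by (intro borel_measurable_continuous_onI continuous_on_compose2[OF f_cont] continuous_intros) auto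
  interpret \<kappa>: prob_space \<kappa>
    using kappa_L by (simp add: Lclass_def Pfin_def)
  have sets_\<kappa> [measurable_cong]: "sets \<kappa> = sets borel"
    using kappa_L by (simp add: Lclass_def Pfin_def)
  interpret product_sigma_finite "\<lambda>_::nat. \<kappa>"
    by unfold_locales
  interpret P: prob_space P
    unfolding P_def by (intro prob_space_PiM \<kappa>.prob_space_axioms)
  interpret PL: pair_sigma_finite P "lborel :: (real \<times> real) measure"
    by (intro pair_sigma_finite.intro P.sigma_finite_measure_axioms lborel.sigma_finite_measure_axioms)
  define q where "q X \<theta> = (\<Prod>t<n. L \<theta> (X t))" for X :: "nat \<Rightarrow> real" and \<theta>
  \<comment> \<open>The average over \<open>R\<close>, left unnormalised: its expectation is at most
    the area \<open>r\<close>, since each fixed \<open>\<theta>\<close> contributes at most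
    1.\<close>
  define M where "M X = (\<integral>\<^sup>+\<theta>. ennreal (q X \<theta>) * indicator R \<theta> \<partial>lborel)" for X
  have R_meas [measurable]: "R \<in> sets borel"
    using closed_dual_region by (rule borel_closed)
  have q_nonneg: "q X \<theta> \<ge> 0" if "\<theta> \<in> R" for X \<theta>
    using that by (auto simp: q_def dual_region_def intro!: prod_nonneg)
  have L_meas [measurable]: "(\<lambda>p. L (snd p) (fst p t)) \<in> borel_measurable (P \<Otimes>\<^sub>M lborel)"
    if "t < n" for t
  proof -
    have X: "(\<lambda>p. fst p t) \<in> borel_measurable (P \<Otimes>\<^sub>M (lborel :: (real \<times> real) measure))"
      unfolding P_def using that measurable_cong_sets[OF refl sets_\<kappa>]
      by (auto intro!: measurable_compose[OF measurable_fst] measurable_component_singleton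
          simp del: measurable_lborel2)
    have "(\<lambda>p. fst (snd p)) \<in> borel_measurable (P \<Otimes>\<^sub>M (lborel :: (real \<times> real) measure))"
      "(\<lambda>p. snd (snd p)) \<in> borel_measurable (P \<Otimes>\<^sub>M (lborel :: (real \<times> real) measure))"
      by (auto intro!: measurable_compose[OF measurable_snd] borel_measurable_continuous_onI continuous_intros)
    then show ?thesis
      unfolding lagrangian_def
      using X measurable_compose[OF X \<phi>_meas]
      by (intro borel_measurable_diff borel_measurable_times borel_measurable_const)
  qed
  have q_meas [measurable]: "case_prod q \<in> borel_measurable (P \<Otimes>\<^sub>M lborel)"
    unfolding q_def[abs_def] case_prod_beta' using L_meas by (intro borel_measurable_prod) auto
  have [measurable]: "M \<in> borel_measurable P"
    unfolding M_def[abs_def] by measurable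
  have "R \<in> lmeasurable"
    using compact_dual_region by (rule lmeasurable_compact)
  then have "emeasure lborel R < \<infinity>"
    by (simp add: fmeasurable_def)
  with emeasure_dual_region_pos obtain r where r: "emeasure lborel R = ennreal r" "r > 0"
    by (cases "emeasure lborel R") auto
  have "(\<integral>\<^sup>+X. M X \<partial>P) = (\<integral>\<^sup>+\<theta>. (\<integral>\<^sup>+X. ennreal (q X \<theta>) * indicator R \<theta> \<partial>P) \<partial>lborel)"
    unfolding M_def by (rule PL.Fubini'[symmetric]) measurable
  also have "\<dots> \<le> (\<integral>\<^sup>+\<theta>. indicator R \<theta> \<partial>lborel)"
  proof (intro nn_integral_mono)
    fix \<theta> show "(\<integral>\<^sup>+X. ennreal (q X \<theta>) * indicator R \<theta> \<partial>P) \<le> indicator R \<theta>"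
    proof (cases "\<theta> \<in> R")
      case True
      then have l: "L \<theta> y \<ge> 0" for y
        by (simp add: dual_region_def)
      have [measurable]: "L \<theta> \<in> borel_measurable borel"
        unfolding lagrangian_def[abs_def] by measurable
      have "(\<integral>\<^sup>+X. ennreal (q X \<theta>) \<partial>P) = (\<integral>\<^sup>+X. (\<Prod>t<n. ennreal (L \<theta> (X t))) \<partial>P)"
        using l by (simp add: q_def prod_ennreal)
      also have "\<dots> = (\<Prod>t<n. \<integral>\<^sup>+y. ennreal (L \<theta> y) \<partial>\<kappa>)"
        unfolding P_def by (rule product_nn_integral_prod) auto
      also have "\<dots> \<le> 1"
        using nn_integral_lagrangian_le_1[OF kappa_L _ \<phi>_meas \<phi>_nonneg, of \<theta>] True B_pos
        by (intro prod_le_1) (auto simp: m_def)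
      finally show ?thesis
        using True by simp
    qed simp
  qed
  also have "\<dots> = ennreal r"
    using r by simp
  finally have M_le: "(\<integral>\<^sup>+X. M X \<partial>P) \<le> ennreal r" .

  define C where "C = (real n + 1) * (real n + 2) / 2"
  have C: "C > 0" by (simp add: C_def)
  \<comment> \<open>Chosen so that \<open>1 \<le> c * M X\<close> says that the normalised average
    \<open>M X / r\<close> is at least \<open>exp (n * u) / C\<close>.\<close>
  define c where "c = C * exp (- real n * u) / r"
  have c: "c \<ge> 0" using C r by (simp add: c_def)
  define A where "A = {X \<in> space P. 1 \<le> ennreal c * M X}"
  have "A \<in> sets P"
    unfolding A_def by measurable
  moreover have "{X \<in> space P. KLinf f B (empirical n X) m \<ge> ereal u} \<subseteq> A"
  proof
    fix X assume X: "X \<in> {X \<in> space P. KLinf f B (empirical n X) m \<ge> ereal u}"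
    obtain \<theta> where \<theta>: "\<theta> \<in> R" "\<And>t. t < n \<Longrightarrow> L \<theta> (X t) > 0"
      and le: "KLinf f B (empirical n X) m \<le> ereal ((\<Sum>t<n. ln (L \<theta> (X t))) / n)"
      using KLinf_empirical_le_dual[OF moment_constraint_axioms n_pos \<phi>_meas \<phi>_nonneg, of X] by blast
    have "ereal u \<le> ereal ((\<Sum>t<n. ln (L \<theta> (X t))) / n)"
      using X by (intro order_trans[OF _ le]) simp
    then have "real n * u \<le> (\<Sum>t<n. ln (L \<theta> (X t)))"
      using n_pos by (simp add: field_simps)
    then have "exp (real n * u) \<le> exp (\<Sum>t<n. ln (L \<theta> (X t)))"
      by simp
    also have "\<dots> = q X \<theta>"
      using \<theta>(2) by (simp add: exp_sum q_def)
    finally have q: "exp (real n * u) \<le> q X \<theta>" .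
    have [measurable]: "q X \<in> borel_measurable borel"
      unfolding q_def[abs_def] by (intro borel_measurable_continuous_onI continuous_intros)
    \<comment> \<open>\<open>\<theta>\<close> depends on the sample whereas the average
      \<open>M\<close> uses all of \<open>R\<close>; this step removes the dependence.\<close>
    have "ennreal (2 / ((real n + 1) * (real n + 2)) * q X \<theta>) * emeasure lborel R \<le> M X"
      unfolding M_def
    proof (rule mixture_lower_bound[OF n_pos])
      show "q X \<theta> > 0"
        using q exp_gt_zero[of "real n * u"] by linarith
      show "(1 - s) *\<^sub>R \<theta> + s *\<^sub>R b \<in> R" if "b \<in> R" "0 \<le> s" "s \<le> 1" for b s
        using \<theta> that by (intro convex_comb_dual_region)
      show "(1 - s) ^ n * q X \<theta> \<le> q X ((1 - s) *\<^sub>R \<theta> + s *\<^sub>R b)" if "b \<in> R" "0 \<le> s" "s \<le> 1" for b s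
      proof -
        \<comment> \<open>Each factor keeps at least the share \<open>1 - s\<close> of its value at
          \<open>\<theta>\<close>, since the contribution of \<open>b\<close> is
          non-negative.\<close>
        have "(1 - s) ^ n * q X \<theta> = (\<Prod>t<n. (1 - s) * L \<theta> (X t))"
          by (simp add: q_def prod.distrib)
        also have "\<dots> \<le> q X ((1 - s) *\<^sub>R \<theta> + s *\<^sub>R b)"
          unfolding q_def using \<theta> that
          by (intro prod_mono) (auto simp: lagrangian_convex_comb dual_region_def)
        finally show ?thesis .
      qed
    qed (use q_nonneg in auto)
    then have "ennreal c * (ennreal (2 / ((real n + 1) * (real n + 2)) * q X \<theta>) * ennreal r) \<le> ennreal c * M X"
      unfolding r by (rule mult_left_mono) simp
    moreover have "1 \<le> c * (2 / ((real n + 1) * (real n + 2)) * q X \<theta> * r)"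
    proof -
      have "1 = exp (- real n * u) * exp (real n * u)"
        by (simp add: exp_minus)
      also have "\<dots> \<le> exp (- real n * u) * q X \<theta>"
        using q by simp
      also have "\<dots> = c * (1 / C * q X \<theta> * r)"
        using r C by (simp add: c_def)
      also have "1 / C = 2 / ((real n + 1) * (real n + 2))"
        by (simp add: C_def)
      finally show ?thesis .
    qed
    ultimately have "1 \<le> ennreal c * M X"
      using c r q_nonneg[OF \<theta>(1), of X]
      by (auto simp: ennreal_mult[symmetric] elim!: order_trans[rotated])
    then show "X \<in> A"
      using X by (simp add: A_def)
  qed
  moreover have "measure P A \<le> (real n + 1)^2
      * exp ((\<integral>x. \<bar>x - m\<bar> \<partial>\<kappa>) / (2 * (finv f B - m)) + (\<integral>x. \<bar>B - f \<bar>x\<bar>\<bar> \<partial>\<kappa>) / (2 * (B - f \<bar>m\<bar>)))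
      * exp (- real n * u)" (is "_ \<le> _ * exp ?d * _")
  proof -
    have "emeasure P A \<le> ennreal c * (\<integral>\<^sup>+X. M X * indicator (space P) X \<partial>P)"
      unfolding A_def by (rule nn_integral_Markov_inequality) auto
    also have "(\<integral>\<^sup>+X. M X * indicator (space P) X \<partial>P) = (\<integral>\<^sup>+X. M X \<partial>P)"
      by (intro nn_integral_cong) simp
    also have "ennreal c * (\<integral>\<^sup>+X. M X \<partial>P) \<le> ennreal c * ennreal r"
      using M_le by (rule mult_left_mono) simp
    also have "\<dots> = ennreal (C * exp (- real n * u))"
      using c r by (simp add: ennreal_mult[symmetric] c_def)
    finally have "measure P A \<le> C * exp (- real n * u)"
      using C by (simp add: P.emeasure_eq_measure)
    \<comment> \<open>\<open>?d\<close> is non-negative, and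
      \<open>(n + 1) * (n + 2) / 2 \<le> (n + 1)^2\<close>.\<close>
    also have "\<dots> \<le> (real n + 1)^2 * exp ?d * exp (- real n * u)"
    proof (rule mult_right_mono)
      have "\<bar>m\<bar> < finv f B"
        using abs_less_finv[OF f_mono f_cont f_superlin B_pos] mean_lt by (simp add: m_def)
      then have "0 \<le> ?d"
        using mean_interior by (intro add_nonneg_nonneg divide_nonneg_nonneg integral_nonneg) auto
      then have "(real n + 1)^2 * 1 \<le> (real n + 1)^2 * exp ?d"
        by (intro mult_left_mono) simp_all
      moreover have "C \<le> (real n + 1)^2"
        using n_pos by (simp add: C_def power2_eq_square field_simps)
      ultimately show "C \<le> (real n + 1)^2 * exp ?d"
        by linarith
    qed simp
    finally show ?thesis .
  qed
  ultimately show ?thesis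
    unfolding P_def m_def by blast
qed

end
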